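(* Let a cluster (disk) of radius $\rho>0$ in the plane $\mathbb{P}$ contain $N\ge1$ UEs whose locations are independent and uniformly distributed in the disk, and let a satellite be at altitude $h>0$ above $\mathbb{P}$ with slant range $s_t\ge h$ relative to the cluster center at time $t$. Let $F^{t}_{\chi,\mathrm{M}}$ and $f^{t}_{\chi,\mathrm{M}}$ be the CDF and PDF, as given in the context, of the Doppler shift magnitude at a single uniformly located UE in the cluster. Then the minimum of the Doppler shift magnitudes of the $N$ UEs in the cluster has CDF $$F^{t}_{\chi_{\min},\mathrm{M}}(x)=1-\left(1-F^{t}_{\chi,\mathrm{M}}(x)\right)^N$$ and PDF $$f^{t}_{\chi_{\min},\mathrm{M}}(x)=N\left(1-F^{t}_{\chi,\mathrm{M}}(x)\right)^{N-1}f^{t}_{\chi,\mathrm{M}}(x),\qquad 0\le x<A.$$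
   Context: Setting: UEs (user equipments) lie on a plane $\mathbb{P}$ (flat-earth approximation). The satellite at altitude $h$ has orthogonal projection $\mathcal{P}_t$ (sub-satellite point) on $\mathbb{P}$ at time $t$; $s_t$ is the distance from the satellite to the cluster center, and $\hat R_t=\sqrt{s_t^2-h^2}$. Satellite location and cluster center are fixed. Parameters (positive constants unless stated): carrier frequency $f_c$, speed of light $c$, earth radius $r_E$, orbital radius $r_o=r_E+h$, angular velocities $\omega_s$ (satellite) and $\omega_E$ (earth), orbital inclination $\theta_i\in\mathbb{R}$, $\omega_F=\omega_s+\omega_E\cos\theta_i>0$, and $A=\frac{f_c r_o\omega_F}{c}$. Doppler model: for a UE at distance $z_t$ in $\mathbb{P}$ from $\mathcal{P}_t$, the Doppler shift magnitude is $|\chi_t|=\frac{f_c r_E\omega_F}{c}\,\kappa_t$ with $\kappa_t=\frac{r_o z_t}{r_E\sqrt{h^2+z_t^2}}$ (the flat-earth expression used for the cosine of the elevation angle). Single-UE distribution: for $0\le x<A$, $$F^{t}_{\chi,\mathrm{M}}(x)=F_{\mathrm{M}}\!\left(\tfrac{hx}{\sqrt{A^2-x^2}},\rho\,\big|\,\hat R_t\right),\qquad f^{t}_{\chi,\mathrm{M}}(x)=\tfrac{hA^2}{(A^2-x^2)^{3/2}}\,f_{\mathrm{M}}\!\left(\tfrac{hx}{\sqrt{A^2-x^2}},\rho\,\big|\,\hat R_t\right),$$ where $F_{\mathrm{M}}(r,R|\hat R)=\frac{r^2}{R^2}$ and $f_{\mathrm{M}}(r,R|\hat R)=\frac{2r}{R^2}$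 for $0\le r\le R-\hat R$; for $|R-\hat R|<r\le R+\hat R$, $F_{\mathrm{M}}(r,R|\hat R)=\frac{r^2}{\pi R^2}(\theta^*-\frac12\sin 2\theta^* )+\frac1\pi(\phi^*-\frac12\sin2\phi^* )$ and $f_{\mathrm{M}}(r,R|\hat R)=\frac{2r\theta^*}{\pi R^2}$ with $\theta^*=\cos^{-1}\frac{r^2+\hat R^2-R^2}{2\hat Rr}$, $\phi^*=\cos^{-1}\frac{R^2+\hat R^2-r^2}{2\hat RR}$; for $0\le r\le\hat R-R$ with $\hat R>R$, $F_{\mathrm{M}}=f_{\mathrm{M}}=0$; for $r>R+\hat R$, $F_{\mathrm{M}}=1$, $f_{\mathrm{M}}=0$. *)

theory Defs
  imports "HOL-Probability.Probability"
begin

(* The plane of the UEs is real * real with its Euclidean metric and Lebesgue measure.  Space is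
   plane * real, the last coordinate being the height above the plane, so the satellite with
   sub-satellite point P at altitude h is the point (P, h). *)
type_synonym plane = "real \<times> real"

definition slant_range :: "plane \<Rightarrow> real \<Rightarrow> plane \<Rightarrow> real" where
  "slant_range P h C = dist (P, h) (C, 0)"

definition kappa :: "real \<Rightarrow> real \<Rightarrow> real \<Rightarrow> real \<Rightarrow> real" where
  "kappa r_E r_o h z = r_o * z / (r_E * sqrt (h\<^sup>2 + z\<^sup>2))"

definition doppler_mag ::
    "real \<Rightarrow> real \<Rightarrow> real \<Rightarrow> real \<Rightarrow> real \<Rightarrow> real \<Rightarrow> real \<Rightarrow> real" where
  "doppler_mag f_c c omega_F r_E r_o h z = f_c * r_E * omega_F / c * kappa r_E r_o h z"

definition theta_star :: "real \<Rightarrow> real \<Rightarrow> real \<Rightarrow> real" where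
  "theta_star r R Rh = arccos ((r\<^sup>2 + Rh\<^sup>2 - R\<^sup>2) / (2 * Rh * r))"

definition phi_star :: "real \<Rightarrow> real \<Rightarrow> real \<Rightarrow> real" where
  "phi_star r R Rh = arccos ((R\<^sup>2 + Rh\<^sup>2 - r\<^sup>2) / (2 * Rh * R))"

(* F_M and f_M are the claimed CDF and PDF of the distance r from a uniform point of a disk of
   radius R to a fixed point at distance Rh from its centre.  Only r >= 0 is meaningful; the last
   branch of F_M is reached only for r < 0. *)
definition F_M :: "real \<Rightarrow> real \<Rightarrow> real \<Rightarrow> real" where
  "F_M r R Rh =
    (if 0 \<le> r \<and> r \<le> R - Rh then r\<^sup>2 / R\<^sup>2
     else if \<bar>R - Rh\<bar> < r \<and> r \<le> R + Rh then
       r\<^sup>2 / (pi * R\<^sup>2) * (theta_star r R Rh - 1/2 * sin (2 * theta_star r R Rh))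
       + 1 / pi * (phi_star r R Rh - 1/2 * sin (2 * phi_star r R Rh))
     else if R < Rh \<and> 0 \<le> r \<and> r \<le> Rh - R then 0
     else if R + Rh < r then 1
     else 0)"

definition f_M :: "real \<Rightarrow> real \<Rightarrow> real \<Rightarrow> real" where
  "f_M r R Rh =
    (if 0 \<le> r \<and> r \<le> R - Rh then 2 * r / R\<^sup>2
     else if \<bar>R - Rh\<bar> < r \<and> r \<le> R + Rh then 2 * r * theta_star r R Rh / (pi * R\<^sup>2)
     else 0)"

definition F_chi :: "real \<Rightarrow> real \<Rightarrow> real \<Rightarrow> real \<Rightarrow> real \<Rightarrow> real" where
  "F_chi h A \<rho> Rh x = F_M (h * x / sqrt (A\<^sup>2 - x\<^sup>2)) \<rho> Rh"

definition f_chi :: "real \<Rightarrow> real \<Rightarrow> real \<Rightarrow> real \<Rightarrow> real \<Rightarrow> real" where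
  "f_chi h A \<rho> Rh x =
     h * A\<^sup>2 / (A\<^sup>2 - x\<^sup>2) powr (3/2) * f_M (h * x / sqrt (A\<^sup>2 - x\<^sup>2)) \<rho> Rh"

end

theory Submission
  imports Defs
begin

text \<open>
  Two overlapping disks meet in the union of two circular segments cut off by their radical line;
  adding the segment areas shows that \<^term>\<open>F_M\<close> is the distribution function of the
  distance from a uniform point of a disk to a fixed point. The Doppler magnitude is a strictly
  increasing function of this distance, so independence gives the distribution function of the
  minimum. That function has no jumps and is differentiable off finitely many points, where the
  two circles are tangent or the magnitude is \<open>0\<close> or \<open>A\<close>; a distribution function of this kind is
  the integral of its derivative.
\<close>

subsection \<open>Planar measure-preserving maps\<close>

text \<open>The formulas for \<open>F_M\<close> and \<open>f_M\<close> are piecewise, and the lens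
  branch is awkward where the circles become tangent. Differentiability is therefore claimed only
  away from tangency, and continuity at the remaining points is not read off the formulas: one value
  of the magnitude determines the distance to \<open>P\<close>, so it confines some user to a
  circle, which is Lebesgue null. Without this a point mass could hide at an exceptional point, and
  the derivative would not be a density. The area computation slices by vertical lines, which suits
  a vertical radical line, hence centres on the first coordinate axis. Bringing an arbitrary pair of
  centres there needs rotation invariance of planar Lebesgue measure. Shears give it: each one
  translates the slices parallel to an axis, so it reduces to translation invariance in one
  dimension.\<close>

lemma lborel_distr_shear_fst:
  "distr lborel borel (\<lambda>(x, y). (x + t * y, y)) = (lborel :: (real \<times> real) measure)" 
    (is "distr _ _ ?T = _")
proof (rule measure_eqI)
  fix S :: "(real \<times> real) set" assume "S \<in> sets (distr lborel borel ?T)"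
  hence S[measurable]: "S \<in> sets borel" by simp
  have T[measurable]: "?T \<in> borel_measurable borel"
    unfolding borel_prod[symmetric] by measurable
  have S': "?T -` S \<in> sets borel"
    using measurable_sets[OF T S] by simp
  \<comment> \<open>On the line at height \<open>y\<close> the shear is the translation by
    \<open>t * y\<close>.\<close>
  have eq: "emeasure lborel ((\<lambda>x. (x, y)) -` ?T -` S) = emeasure lborel ((\<lambda>x. (x, y)) -` S)" for y
  proof -
    have "(\<lambda>x. (x, y)) -` S \<in> sets borel"
      using S unfolding borel_prod[symmetric] by (rule sets_Pair2)
    then have "emeasure (distr lborel borel ((+) (t * y))) ((\<lambda>x. (x, y)) -` S) =
        emeasure lborel ((+) (t * y) -` (\<lambda>x. (x, y)) -` S)"
      by (subst emeasure_distr) auto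
    also have "(+) (t * y) -` (\<lambda>x. (x, y)) -` S = (\<lambda>x. (x, y)) -` ?T -` S"
      by (auto simp: add.commute)
    finally show ?thesis by (simp add: lborel_distr_plus)
  qed
  have "emeasure (distr lborel borel ?T) S = emeasure (lborel \<Otimes>\<^sub>M lborel) (?T -` S)"
    by (simp add: emeasure_distr lborel_prod)
  also have "\<dots> = (\<integral>\<^sup>+y. emeasure lborel ((\<lambda>x. (x, y)) -` ?T -` S) \<partial>lborel)"
    using S' by (intro lborel_pair.emeasure_pair_measure_alt2) (simp only: lborel_prod sets_lborel)
  also have "\<dots> = emeasure (lborel \<Otimes>\<^sub>M lborel) S"
    unfolding eq using S by (subst lborel_pair.emeasure_pair_measure_alt2) (simp_all only: lborel_prod sets_lborel)
  finally show "emeasure (distr lborel borel ?T) S = emeasure lborel S" by (simp add: lborel_prod)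
qed simp

lemma lborel_distr_comp:
  assumes "f \<in> borel_measurable borel" "g \<in> borel_measurable borel"
    and "distr lborel borel f = lborel" "distr lborel borel g = lborel"
  shows "distr lborel borel (g \<circ> f) = lborel"
  using assms distr_distr[of g borel borel f lborel] by simp

text \<open>This is the other shear conjugated by the coordinate swap, which also preserves the
  measure.\<close>

lemma lborel_distr_shear_snd:
  "distr lborel borel (\<lambda>(x, y). (x, y + t * x)) = (lborel :: (real \<times> real) measure)"
proof -
  let ?T = "\<lambda>(x::real, y::real). (x + t * y, y)" and ?s = "\<lambda>(x::real, y::real). (y, x)"
  have T[measurable]: "?T \<in> borel_measurable borel" and s[measurable]: "?s \<in> borel_measurable borel"
    unfolding borel_prod[symmetric] by measurable
  have swap: "distr lborel borel ?s = lborel"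
    using lborel_pair.distr_pair_swap[where ?'a=real and ?'b=real]
      distr_cong[of lborel lborel lborel borel ?s ?s]
    by (simp add: lborel_prod)
  have "(\<lambda>(x, y). (x, y + t * x)) = ?s \<circ> (?T \<circ> ?s)"
    by auto
  then show ?thesis
    by (simp only:) (rule lborel_distr_comp[OF measurable_comp[OF s T] s
      lborel_distr_comp[OF s T swap lborel_distr_shear_fst] swap])
qed

lemma lborel_distr_diff:
  fixes c :: "'a::euclidean_space"
  shows "distr lborel borel (\<lambda>x. c - x) = lborel"
  by (subst lborel_affine[of "-1" c]) (auto simp: density_1 one_ennreal_def[symmetric])

text \<open>\<open>u\<close> and \<open>v\<close> are the cosine and sine of the angle; the
  orientation is the one that sends \<open>(u, v)\<close> to \<open>(1, 0)\<close>.\<close>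

lemma lborel_distr_rotation:
  fixes u v :: real
  assumes "u\<^sup>2 + v\<^sup>2 = 1"
  shows "distr lborel borel (\<lambda>(x, y). (u * x + v * y, u * y - v * x)) = (lborel :: (real \<times> real) measure)"
proof (cases "u = -1")
  \<comment> \<open>For a half turn the tangent of the half angle is infinite; the map is then the
    point reflection.\<close>
  case True
  then have "(\<lambda>(x, y). (u * x + v * y, u * y - v * x)) = (\<lambda>p. 0 - p)"
    using assms by (auto simp: fun_eq_iff)
  then show ?thesis using lborel_distr_diff[of "0 :: real \<times> real"] by simp
next
  case False
  \<comment> \<open>A rotation is a product of three shears; \<open>t\<close> is the tangent of half its angle.\<close>
  define t where "t = v / (1 + u)"
  have u: "1 + u \<noteq> 0" using False by linarith
  have t: "t * v = 1 - u" "t * (1 + u) = v"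
  proof -
    have "v * v = (1 - u) * (1 + u)" using assms by (simp add: power2_eq_square algebra_simps)
    then show "t * v = 1 - u" using u by (simp add: t_def field_simps)
    show "t * (1 + u) = v" using u by (simp add: t_def)
  qed
  let ?S = "\<lambda>(x::real, y::real). (x + t * y, y)"
  let ?V = "\<lambda>(x::real, y::real). (x, y + (- v) * x)"
  have S[measurable]: "?S \<in> borel_measurable borel" and V[measurable]: "?V \<in> borel_measurable borel"
    unfolding borel_prod[symmetric] by measurable
  have "(\<lambda>(x, y). (u * x + v * y, u * y - v * x)) = ?S \<circ> (?V \<circ> ?S)"
  proof (intro ext, clarsimp, intro conjI)
    fix x y :: real
    have "x + t * y + t * (y - v * (x + t * y)) = x + 2 * (t * y) - (t * v) * x - (t * v) * (t * y)"
      by (simp add: algebra_simps)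
    also have "\<dots> = u * x + (t * (1 + u)) * y" by (simp only: t(1)) (simp add: algebra_simps)
    finally show "u * x + v * y = x + t * y + t * (y - v * (x + t * y))" by (simp only: t(2))
    have "y - v * (x + t * y) = y - v * x - (t * v) * y" by (simp add: algebra_simps)
    also have "\<dots> = u * y - v * x" by (simp only: t(1)) (simp add: algebra_simps)
    finally show "u * y - v * x = y - v * (x + t * y)" by simp
  qed
  then show ?thesis
    by (simp only:) (rule lborel_distr_comp[OF measurable_comp[OF S V] S
      lborel_distr_comp[OF S V lborel_distr_shear_fst lborel_distr_shear_snd] lborel_distr_shear_fst])
qed

subsection \<open>Circular segments and lenses\<close>

text \<open>A sector of angle \<open>2 * arccos (a / R)\<close> less the triangle on its chord.
  Negative \<open>a\<close> is allowed because the radical line may lie beyond a centre: the segment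
  then exceeds half the disk, and the sign of the sine adds the triangle instead.\<close>

lemma emeasure_circular_segment:
  fixes a R :: real
  assumes R: "R > 0" and a: "-R \<le> a" "a \<le> R"
  shows "emeasure lborel {p :: real \<times> real. (fst p)\<^sup>2 + (snd p)\<^sup>2 \<le> R\<^sup>2 \<and> a \<le> fst p} =
    ennreal (R\<^sup>2 * (arccos (a / R) - 1/2 * sin (2 * arccos (a / R))))" (is "emeasure _ ?S = _")
proof -
  \<comment> \<open>An antiderivative of the chord length
    \<open>2 * sqrt (R\<^sup>2 - x\<^sup>2)\<close>; using \<open>- arccos\<close> rather than
    \<open>arcsin\<close> makes it vanish at \<open>R\<close>.\<close>
  define G where "G x = x * sqrt (R\<^sup>2 - x\<^sup>2) - R\<^sup>2 * arccos (x / R)" for x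
  have closed: "closed ?S"
    unfolding Collect_conj_eq by (intro closed_Int closed_Collect_le continuous_intros)
  have sect: "emeasure lborel (Pair x -` ?S) = ennreal (2 * sqrt (R\<^sup>2 - x\<^sup>2)) * indicator {a..R} x" for x
  proof (cases "a \<le> x \<and> x \<le> R")
    case True
    then have x: "x\<^sup>2 \<le> R\<^sup>2" using a by (intro power2_le_iff_abs_le[THEN iffD2]) auto
    have "Pair x -` ?S = {- sqrt (R\<^sup>2 - x\<^sup>2) .. sqrt (R\<^sup>2 - x\<^sup>2)}"
    proof (rule set_eqI)
      fix y
      have "x\<^sup>2 + y\<^sup>2 \<le> R\<^sup>2 \<longleftrightarrow> \<bar>y\<bar> \<le> sqrt (R\<^sup>2 - x\<^sup>2)"
        using real_sqrt_le_iff[of "y\<^sup>2" "R\<^sup>2 - x\<^sup>2"] by (simp add: algebra_simps)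
      then show "y \<in> Pair x -` ?S \<longleftrightarrow> y \<in> {- sqrt (R\<^sup>2 - x\<^sup>2) .. sqrt (R\<^sup>2 - x\<^sup>2)}"
        using True by (simp only: vimage_eq mem_Collect_eq fst_conv snd_conv
          atLeastAtMost_iff abs_le_iff minus_le_iff[of y]) blast
    qed
    then show ?thesis using True x by (auto simp: indicator_def)
  next
    case False
    have "Pair x -` ?S = {}"
    proof (safe, simp)
      fix y assume y: "x\<^sup>2 + y\<^sup>2 \<le> R\<^sup>2" "a \<le> x"
      then have "x\<^sup>2 \<le> R\<^sup>2" by (smt (verit) zero_le_power2)
      then show False using False y R by (simp add: power2_le_iff_abs_le)
    qed
    then show ?thesis using False by (auto simp: indicator_def)
  qed
  have nonneg: "0 \<le> 2 * sqrt (R\<^sup>2 - x\<^sup>2)" if "x \<in> {a..R}" for x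
    using that a by (simp add: power2_le_iff_abs_le abs_le_iff)
  have "((\<lambda>x. 2 * sqrt (R\<^sup>2 - x\<^sup>2)) has_integral (G R - G a)) {a..R}"
  proof (rule fundamental_theorem_of_calculus_interior)
    \<comment> \<open>The root and \<open>arccos\<close> are not differentiable at \<open>R\<close>,
      so continuity is used up to the ends and derivatives only inside.\<close>
    show "continuous_on {a..R} G"
      unfolding G_def using a R by (intro continuous_intros) (auto simp: field_simps)
  next
    fix x assume x: "x \<in> {a<..<R}"
    have lt: "x\<^sup>2 < R\<^sup>2"
    proof -
      have "0 < (R - x) * (R + x)" using x a by (intro mult_pos_pos) auto
      then show ?thesis by (simp add: power2_eq_square algebra_simps)
    qed
    have lt1: "-1 < x / R" "x / R < 1" using x a R by (auto simp: field_simps)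
    define w where "w = sqrt (R\<^sup>2 - x\<^sup>2)"
    have w: "w > 0" "w * w = R\<^sup>2 - x\<^sup>2" using lt by (auto simp: w_def)
    have "sqrt (1 - (x / R)\<^sup>2) = sqrt ((R\<^sup>2 - x\<^sup>2) / R\<^sup>2)"
      using R by (simp add: field_simps)
    then have w': "sqrt (1 - (x / R)\<^sup>2) = w / R" using R by (simp add: w_def real_sqrt_divide)
    have "(G has_real_derivative (w + x * (inverse w / 2 * (- (2 * x))) - R\<^sup>2 * (inverse (- (w / R)) * (1 / R)))) (at x)"
      unfolding G_def using lt lt1 R
      by (auto intro!: derivative_eq_intros simp: w'[symmetric] w_def[symmetric])
    moreover have "w + x * (inverse w / 2 * (- (2 * x))) - R\<^sup>2 * (inverse (- (w / R)) * (1 / R)) = 2 * w"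
      using w R by (simp add: field_simps power2_eq_square)
    ultimately show "(G has_vector_derivative 2 * sqrt (R\<^sup>2 - x\<^sup>2)) (at x)"
      by (simp only: has_real_derivative_iff_has_vector_derivative w_def[symmetric])
  qed (use a in auto)
  from nn_integral_has_integral_lebesgue[OF nonneg this]
  have "(\<integral>\<^sup>+x. ennreal (2 * sqrt (R\<^sup>2 - x\<^sup>2)) * indicator {a..R} x \<partial>lborel) = ennreal (G R - G a)"
    by (simp add: indicator_mult_ennreal mult.commute)
  moreover have "G R - G a = R\<^sup>2 * (arccos (a / R) - 1/2 * sin (2 * arccos (a / R)))"
  proof -
    have "sin (2 * arccos (a / R)) = 2 * sqrt (1 - (a / R)\<^sup>2) * (a / R)"
      using a R by (simp add: sin_double sin_arccos field_simps)
    moreover have "sqrt (1 - (a / R)\<^sup>2) = sqrt (R\<^sup>2 - a\<^sup>2) / R"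
    proof -
      have "1 - (a/R)\<^sup>2 = (R\<^sup>2 - a\<^sup>2) / R\<^sup>2" using R by (simp add: field_simps)
      then show ?thesis using R by (simp add: real_sqrt_divide)
    qed
    ultimately show ?thesis using R by (simp add: G_def field_simps power2_eq_square)
  qed
  moreover have "emeasure lborel ?S = (\<integral>\<^sup>+x. emeasure lborel (Pair x -` ?S) \<partial>lborel)"
    using borel_closed[OF closed]
    by (subst lborel_prod[symmetric], intro lborel.emeasure_pair_measure_alt) (simp only: lborel_prod sets_lborel)
  ultimately show ?thesis by (simp only: sect)
qed

text \<open>Moves the first centre to the origin and the second onto the first axis by a
  measure-preserving isometry, so that the radical line becomes vertical.\<close>

lemma emeasure_cball_Int_rotate:
  fixes P C :: "real \<times> real"
  assumes "P \<noteq> C"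
  shows "emeasure lborel (cball C R \<inter> cball P r) =
    emeasure lborel (cball 0 R \<inter> cball (dist C P, 0 :: real) r)"
proof -
  define d where "d = dist C P"
  have d: "d > 0" using assms by (simp add: d_def)
  \<comment> \<open>\<open>(u, v)\<close> is the unit vector from \<open>C\<close> towards
    \<open>P\<close>.\<close>
  define u v where "u = (fst P - fst C) / d" and "v = (snd P - snd C) / d"
  have d2: "d\<^sup>2 = (fst P - fst C)\<^sup>2 + (snd P - snd C)\<^sup>2"
    by (simp add: d_def dist_prod_def dist_real_def power2_commute)
  have uv: "u\<^sup>2 + v\<^sup>2 = 1"
    using d by (simp add: u_def v_def power_divide add_divide_distrib[symmetric] flip: d2)
  let ?r = "\<lambda>(x::real, y::real). (u * x + v * y, u * y - v * x)"
  define T where "T = ?r \<circ> (+) (- C)"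
  have r: "?r \<in> borel_measurable borel"
    unfolding borel_prod[symmetric] by measurable
  have T: "T \<in> borel_measurable borel" "distr lborel borel T = lborel"
    unfolding T_def
    by (rule measurable_comp[OF _ r] lborel_distr_comp[OF _ r lborel_distr_plus lborel_distr_rotation[OF uv]], measurable)+
  have dist_T: "dist (T p) (T q) = dist p q" for p q
  proof -
    have *: "(u * (a - c) + v * (b - e))\<^sup>2 + (u * (b - e) - v * (a - c))\<^sup>2 = (u\<^sup>2 + v\<^sup>2) * ((a - c)\<^sup>2 + (b - e)\<^sup>2)"
      for a b c e by (simp add: power2_eq_square algebra_simps)
    have "T p = (u * (fst p - fst C) + v * (snd p - snd C), u * (snd p - snd C) - v * (fst p - fst C))" for p
      by (simp add: T_def split_beta)
    then have "fst (T p) - fst (T q) = u * (fst p - fst q) + v * (snd p - snd q)"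
      "snd (T p) - snd (T q) = u * (snd p - snd q) - v * (fst p - fst q)"
      by (simp_all add: algebra_simps)
    then show ?thesis
      using * by (simp add: dist_prod_def dist_real_def uv)
  qed
  have TC: "T C = 0" by (simp add: T_def zero_prod_def)
  have TP: "T P = (d, 0)"
  proof -
    have "T P = (u * (u * d) + v * (v * d), u * (v * d) - v * (u * d))"
      using d by (simp add: T_def split_beta) (simp add: u_def v_def)
    also have "\<dots> = ((u\<^sup>2 + v\<^sup>2) * d, 0)"
      by (simp add: power2_eq_square algebra_simps)
    finally show ?thesis by (simp add: uv)
  qed
  have "emeasure lborel (cball 0 R \<inter> cball (d, 0 :: real) r) = emeasure (distr lborel borel T) (cball 0 R \<inter> cball (d, 0 :: real) r)"
    by (simp only: T)
  also have "\<dots> = emeasure lborel (T -` (cball 0 R \<inter> cball (d, 0 :: real) r))"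
    using T(1) by (subst emeasure_distr) auto
  also have "T -` (cball 0 R \<inter> cball (d, 0 :: real) r) = cball C R \<inter> cball P r"
    unfolding TC[symmetric] TP[symmetric] by (intro set_eqI) (simp only: vimage_eq Int_iff mem_cball dist_T)
  finally show ?thesis by (simp add: d_def)
qed

lemma measure_lens:
  fixes P C :: "real \<times> real"
  defines "d \<equiv> dist C P"
  assumes R: "R > 0" and r: "\<bar>R - d\<bar> < r" "r \<le> R + d"
  shows "measure lborel (cball C R \<inter> cball P r) =
    R\<^sup>2 * (arccos ((R\<^sup>2 + d\<^sup>2 - r\<^sup>2) / (2 * d * R)) - 1/2 * sin (2 * arccos ((R\<^sup>2 + d\<^sup>2 - r\<^sup>2) / (2 * d * R)))) +
      r\<^sup>2 * (arccos ((r\<^sup>2 + d\<^sup>2 - R\<^sup>2) / (2 * d * r)) - 1/2 * sin (2 * arccos ((r\<^sup>2 + d\<^sup>2 - R\<^sup>2) / (2 * d * r))))"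
proof -
  have d: "d > 0" using r zero_le_dist[of C P] by (cases "d = 0") (auto simp: d_def)
  have r0: "r > 0" using r by linarith
  \<comment> \<open>the signed distance from the first centre to the radical line\<close>
  define a where "a = (R\<^sup>2 + d\<^sup>2 - r\<^sup>2) / (2 * d)"
  have a: "2 * d * a = R\<^sup>2 + d\<^sup>2 - r\<^sup>2" using d by (simp add: a_def)
  have b: "2 * d * (d - a) = r\<^sup>2 + d\<^sup>2 - R\<^sup>2" using a by (simp add: algebra_simps power2_eq_square)
  \<comment> \<open>These products are the differences of squares \<open>2 * d * (a + R)\<close>,
    \<open>2 * d * (R - a)\<close>, \<open>2 * d * (d - a + r)\<close> and
    \<open>2 * d * (r - (d - a))\<close>; thus the radical line meets both closed disks.\<close>
  have "0 \<le> (R + d - r) * (R + d + r)" "0 \<le> (r - (R - d)) * (r + (R - d))"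
    "0 \<le> (r + d - R) * (r + d + R)" "0 \<le> (R - r + d) * (R + r - d)"
    using R d r r0 by auto
  then have "2 * d * (-R) \<le> 2 * d * a" "2 * d * a \<le> 2 * d * R"
    "2 * d * (- r) \<le> 2 * d * (d - a)" "2 * d * (d - a) \<le> 2 * d * r"
    unfolding a b by (auto simp: algebra_simps power2_eq_square)
  then have bounds: "-R \<le> a" "a \<le> R" "-r \<le> d - a" "d - a \<le> r"
    using d by (simp_all only: mult_le_cancel_left_pos)
  define S1 where "S1 = {p :: real \<times> real. (fst p)\<^sup>2 + (snd p)\<^sup>2 \<le> R\<^sup>2 \<and> a \<le> fst p}"
  define S2 where "S2 = {p :: real \<times> real. (fst p)\<^sup>2 + (snd p)\<^sup>2 \<le> r\<^sup>2 \<and> d - a \<le> fst p}"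
  \<comment> \<open>The point reflection exchanging the two centres turns a right-hand segment about
    the origin into the left-hand segment about \<open>(d, 0)\<close>, so one area formula serves
    both.\<close>
  define S2' where "S2' = (\<lambda>p. (d, 0) - p) -` S2"
  have closed: "closed S1" "closed S2"
    unfolding S1_def S2_def Collect_conj_eq by (intro closed_Int closed_Collect_le continuous_intros)+
  have closed': "closed S2'"
    unfolding S2'_def by (intro closed_vimage closed continuous_intros)
  have cball_iff: "p \<in> cball (e, 0) s \<longleftrightarrow> (fst p - e)\<^sup>2 + (snd p)\<^sup>2 \<le> s\<^sup>2" if "s > 0" for e s :: real and p
    using that real_sqrt_le_iff[of "(fst p - e)\<^sup>2 + (snd p)\<^sup>2" "s\<^sup>2"]
    by (simp add: dist_prod_def dist_real_def power2_commute)
  have "p \<in> cball 0 R \<inter> cball (d, 0 :: real) r \<longleftrightarrow> p \<in> S1 \<union> S2'" for p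
  proof -
    obtain x y where p: "p = (x, y)" by force
    \<comment> \<open>The powers of a point with respect to the two circles differ by
      \<open>2 * d * (a - x)\<close>. To the right of the line the first disk is therefore the more
      restrictive one, to the left the second.\<close>
    have k: "(x - d)\<^sup>2 + y\<^sup>2 - r\<^sup>2 = x\<^sup>2 + y\<^sup>2 - R\<^sup>2 + 2 * d * (a - x)"
      using a by (simp add: algebra_simps power2_eq_square)
    have sgn: "0 \<le> 2 * d * (a - x) \<longleftrightarrow> x \<le> a" "2 * d * (a - x) \<le> 0 \<longleftrightarrow> a \<le> x"
      using d by (auto simp: zero_le_mult_iff mult_le_0_iff)
    have "p \<in> cball 0 R \<longleftrightarrow> x\<^sup>2 + y\<^sup>2 \<le> R\<^sup>2" "p \<in> cball (d, 0) r \<longleftrightarrow> (x - d)\<^sup>2 + y\<^sup>2 \<le> r\<^sup>2"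
      using cball_iff[OF R, of p 0] cball_iff[OF r0, of p d] by (simp_all add: p zero_prod_def)
    moreover have "p \<in> S1 \<longleftrightarrow> x\<^sup>2 + y\<^sup>2 \<le> R\<^sup>2 \<and> a \<le> x" "p \<in> S2' \<longleftrightarrow> (x - d)\<^sup>2 + y\<^sup>2 \<le> r\<^sup>2 \<and> x \<le> a"
      by (simp_all add: p S1_def S2_def S2'_def power2_commute[of d x])
    ultimately show ?thesis
      using k sgn unfolding Int_iff Un_iff by (smt (verit))
  qed
  then have lens: "cball 0 R \<inter> cball (d, 0 :: real) r = S1 \<union> S2'" by blast
  have "S1 \<inter> S2' \<subseteq> {p. fst p = a}"
    by (auto simp: S1_def S2_def S2'_def)
  moreover have "{p :: real \<times> real. fst p = a} \<in> null_sets lborel"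
  proof -
    have "{p :: real \<times> real. fst p = a} = {p. p \<bullet> (1, 0) = a}" by (auto simp: inner_prod_def)
    then show ?thesis
      using negligible_standard_hyperplane[of "(1, 0) :: real \<times> real" a]
      by (simp add: Basis_prod_def negligible_iff_null_sets null_sets_completion_iff closed_hyperplane)
  qed
  ultimately have "S1 \<inter> S2' \<in> null_sets lborel"
    using closed closed' by (elim null_sets_subset[rotated 2, of _ "{p. fst p = a}"]) auto
  then have "emeasure lborel (S1 \<union> S2') = emeasure lborel S1 + emeasure lborel S2'"
    using closed closed' by (intro emeasure_Un') auto
  also have "emeasure lborel S2' = emeasure lborel S2"
  proof -
    have "emeasure lborel S2 = emeasure (distr lborel borel (\<lambda>p. (d, 0) - p)) S2" by (simp only: lborel_distr_diff)
    also have "\<dots> = emeasure lborel S2'" using closed by (subst emeasure_distr) (auto simp: S2'_def)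
    finally show ?thesis ..
  qed
  also have "emeasure lborel S1 = ennreal (R\<^sup>2 * (arccos (a / R) - 1/2 * sin (2 * arccos (a / R))))"
    unfolding S1_def using R bounds by (intro emeasure_circular_segment)
  also have "emeasure lborel S2 = ennreal (r\<^sup>2 * (arccos ((d - a) / r) - 1/2 * sin (2 * arccos ((d - a) / r))))"
    unfolding S2_def using r0 bounds by (intro emeasure_circular_segment)
  finally have "emeasure lborel (cball 0 R \<inter> cball (d, 0 :: real) r) =
    ennreal (R\<^sup>2 * (arccos (a / R) - 1/2 * sin (2 * arccos (a / R)))) +
    ennreal (r\<^sup>2 * (arccos ((d - a) / r) - 1/2 * sin (2 * arccos ((d - a) / r))))"
    by (simp only: lens)
  moreover have "emeasure lborel (cball C R \<inter> cball P r) = emeasure lborel (cball 0 R \<inter> cball (d, 0 :: real) r)"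
    using emeasure_cball_Int_rotate[of P C R r] d by (auto simp: d_def)
  \<comment> \<open>\<open>ennreal\<close> truncates negative numbers, so the two areas may be added
    as reals only once they are known to be nonnegative; this is
    \<open>sin t \<le> t\<close>.\<close>
  moreover have nonneg: "0 \<le> s * (arccos x - 1/2 * sin (2 * arccos x))"
    if "-1 \<le> x" "x \<le> 1" "0 \<le> s" for x s :: real
    using sin_x_le_x[of "2 * arccos x"] arccos_lbound[of x] that by (intro mult_nonneg_nonneg) auto
  have "0 \<le> R\<^sup>2 * (arccos (a / R) - 1/2 * sin (2 * arccos (a / R)))"
    "0 \<le> r\<^sup>2 * (arccos ((d - a) / r) - 1/2 * sin (2 * arccos ((d - a) / r)))"
    using R r0 bounds by - (rule nonneg; simp add: field_simps)+
  ultimately have "measure lborel (cball C R \<inter> cball P r) =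
    R\<^sup>2 * (arccos (a / R) - 1/2 * sin (2 * arccos (a / R))) +
    r\<^sup>2 * (arccos ((d - a) / r) - 1/2 * sin (2 * arccos ((d - a) / r)))"
    by (simp only: measure_def ennreal_plus[symmetric] enn2real_ennreal add_nonneg_nonneg)
  moreover have "a / R = (R\<^sup>2 + d\<^sup>2 - r\<^sup>2) / (2 * d * R)" "(d - a) / r = (r\<^sup>2 + d\<^sup>2 - R\<^sup>2) / (2 * d * r)"
    unfolding a[symmetric] b[symmetric] using d by auto
  ultimately show ?thesis by (simp only:)
qed

lemma measure_cball_Int_F_M:
  fixes P C :: "real \<times> real"
  assumes R: "R > 0" and r: "r \<ge> 0"
  shows "measure lborel (cball C R \<inter> cball P r) = pi * R\<^sup>2 * F_M r R (dist C P)"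
proof -
  define d where "d = dist C P"
  have disk: "measure lborel (cball p s) = pi * s\<^sup>2" if "s \<ge> 0" for p :: "real \<times> real" and s
    using that content_cball[of s p] by (simp add: eval_unit_ball_vol power2_eq_square)
  \<comment> \<open>The strict \<open>R - d < r\<close> in the third case sends
    \<open>r = 0\<close>, \<open>d = R\<close> to the first, matching the branch order of
    \<open>F_M\<close>.\<close>
  have "r \<le> R - d \<or> \<bar>R - d\<bar> < r \<and> r \<le> R + d \<or> r \<le> d - R \<and> R - d < r \<or> R + d < r"
    by linarith
  then consider "r \<le> R - d" | "\<bar>R - d\<bar> < r" "r \<le> R + d" | "r \<le> d - R" "R - d < r" | "R + d < r"
    by blast
  then have "measure lborel (cball C R \<inter> cball P r) = pi * R\<^sup>2 * F_M r R d"
  proof cases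
    case 1
    then have "cball C R \<inter> cball P r = cball P r"
      by (auto simp: d_def) (smt (verit) dist_triangle dist_commute)
    then show ?thesis using 1 R r by (simp add: F_M_def disk)
  next
    case 2
    then have F: "F_M r R d = r\<^sup>2 / (pi * R\<^sup>2) * (theta_star r R d - 1/2 * sin (2 * theta_star r R d))
       + 1 / pi * (phi_star r R d - 1/2 * sin (2 * phi_star r R d))"
      by (auto simp: F_M_def)
    have "measure lborel (cball C R \<inter> cball P r) =
      R\<^sup>2 * (phi_star r R d - 1/2 * sin (2 * phi_star r R d)) +
      r\<^sup>2 * (theta_star r R d - 1/2 * sin (2 * theta_star r R d))"
      using measure_lens[of R C P r] 2 R by (simp only: theta_star_def phi_star_def d_def)
    also have "\<dots> = pi * R\<^sup>2 * F_M r R d"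
      unfolding F using R by (simp add: field_simps)
    finally show ?thesis .
  next
    case 3
    \<comment> \<open>Closed disks may touch when \<open>r = d - R\<close>, so the intersection need
      not be empty; it lies on the boundary circle.\<close>
    have "cball C R \<inter> cball P r \<subseteq> sphere C R"
    proof
      fix p assume "p \<in> cball C R \<inter> cball P r"
      moreover have "dist C P \<le> dist C p + dist P p" by (metis dist_triangle2)
      ultimately show "p \<in> sphere C R" using 3 by (auto simp: d_def)
    qed
    moreover have "sphere C R \<in> null_sets lborel"
      using negligible_sphere[of C R] by (simp add: negligible_iff_null_sets null_sets_completion_iff)
    ultimately have "measure lborel (cball C R \<inter> cball P r) = 0"
      using null_sets_subset[of "sphere C R" lborel "cball C R \<inter> cball P r"] by (auto simp: measure_def)
    moreover have "F_M r R d = 0"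
      using 3 R r by (auto simp: F_M_def)
    ultimately show ?thesis by simp
  next
    case 4
    then have "cball C R \<inter> cball P r = cball C R"
      by (auto simp: d_def) (smt (verit) dist_triangle dist_commute)
    moreover have "d \<ge> 0" by (simp add: d_def)
    ultimately show ?thesis using 4 R r by (auto simp: F_M_def disk)
  qed
  then show ?thesis by (simp add: d_def)
qed

lemma measure_uniform_cball_cball:
  fixes P C :: "real \<times> real"
  assumes "R > 0" and "r \<ge> 0"
  shows "measure (uniform_measure lborel (cball C R)) (cball P r) = F_M r R (dist C P)"
proof -
  have disk: "emeasure lborel (cball C R) = ennreal (pi * R\<^sup>2)"
    using assms emeasure_cball[of R C] by (simp add: eval_unit_ball_vol power2_eq_square)
  then show ?thesis
    using assms by (subst measure_uniform_measure)
      (auto simp: measure_cball_Int_F_M measure_def[of lborel "cball C R"])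
qed

subsection \<open>The density of the distance to a fixed point\<close>

lemma borel_measurable_arccos [measurable]: "arccos \<in> borel_measurable borel"
proof -
  \<comment> \<open>Off the interval, \<^const>\<open>arccos\<close> is \<open>THE\<close> of an unsatisfiable predicate, hence constant.\<close>
  have "arccos x = indicator {-1..1} x *\<^sub>R arccos x + indicator (- {-1..1}) x * (THE y::real. False)" for x
  proof (cases "x \<in> {-1..1}")
    case False
    then have "(\<lambda>y. 0 \<le> y \<and> y \<le> pi \<and> cos y = x) = (\<lambda>y. False)" by auto
    then have "arccos x = (THE y. False)" unfolding arccos_def by (simp only:)
    then show ?thesis using False by (simp only: indicator_def) simp
  qed simp
  then have *: "arccos = (\<lambda>x. indicator {-1..1} x *\<^sub>R arccos x + indicator (- {-1..1}) x * (THE y::real. False))"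
    by (rule ext)
  have "(\<lambda>x. indicator {-1..1} x *\<^sub>R arccos x) \<in> borel_measurable borel"
    by (intro borel_measurable_continuous_on_indicator continuous_on_arccos') auto
  moreover have "(\<lambda>x. indicator (- {-1..1::real}) x * (THE y::real. False)) \<in> borel_measurable borel"
    by measurable
  ultimately show ?thesis
    by (subst *) (rule borel_measurable_add)
qed

lemma borel_measurable_F_M [measurable]: "(\<lambda>r. F_M r R d) \<in> borel_measurable borel"
  unfolding F_M_def theta_star_def phi_star_def by measurable

lemma borel_measurable_f_M [measurable]: "(\<lambda>r. f_M r R d) \<in> borel_measurable borel"
  unfolding f_M_def theta_star_def by measurable

text \<open>The law of cosines for the angle between sides \<open>a\<close> and \<open>b\<close>:
  the bounds are the triangle inequalities, via \<open>(a + b)\<^sup>2 - c\<^sup>2\<close> and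
  \<open>c\<^sup>2 - (a - b)\<^sup>2\<close>.\<close>

lemma triangle_cosine_bounds:
  fixes a b c :: real
  assumes "a > 0" "b > 0" "\<bar>a - b\<bar> \<le> c" "c \<le> a + b"
  shows "- 1 \<le> (a\<^sup>2 + b\<^sup>2 - c\<^sup>2) / (2 * b * a)" "(a\<^sup>2 + b\<^sup>2 - c\<^sup>2) / (2 * b * a) \<le> 1"
proof -
  have "0 \<le> (a + b - c) * (a + b + c)" "0 \<le> (c - (a - b)) * (c + (a - b))"
    using assms by (intro mult_nonneg_nonneg; linarith)+
  then show "- 1 \<le> (a\<^sup>2 + b\<^sup>2 - c\<^sup>2) / (2 * b * a)" "(a\<^sup>2 + b\<^sup>2 - c\<^sup>2) / (2 * b * a) \<le> 1"
    using assms by (simp_all add: field_simps power2_eq_square)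
qed

text \<open>Strictness keeps the cosine in the open interval where \<open>arccos\<close> is
  differentiable.\<close>

lemma triangle_cosine_strict_bounds:
  fixes a b c :: real
  assumes "a > 0" "b > 0" "\<bar>a - b\<bar> < c" "c < a + b"
  shows "- 1 < (a\<^sup>2 + b\<^sup>2 - c\<^sup>2) / (2 * b * a)" "(a\<^sup>2 + b\<^sup>2 - c\<^sup>2) / (2 * b * a) < 1"
proof -
  have "0 < (a + b - c) * (a + b + c)" "0 < (c - (a - b)) * (c + (a - b))"
    using assms by (intro mult_pos_pos; linarith)+
  then show "- 1 < (a\<^sup>2 + b\<^sup>2 - c\<^sup>2) / (2 * b * a)" "(a\<^sup>2 + b\<^sup>2 - c\<^sup>2) / (2 * b * a) < 1"
    using assms by (simp_all add: field_simps power2_eq_square)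
qed

lemma f_M_nonneg:
  assumes "R > 0" "d \<ge> 0" "r \<ge> 0"
  shows "f_M r R d \<ge> 0"
proof (cases "\<bar>R - d\<bar> < r \<and> r \<le> R + d")
  case True
  then have "r > 0" by linarith
  have "d > 0" using assms True by (cases "d = 0") auto
  then have "theta_star r R d \<ge> 0"
    unfolding theta_star_def using True assms
    by (intro arccos_lbound triangle_cosine_bounds) auto
  then show ?thesis using assms True by (auto simp: f_M_def)
qed (use assms in \<open>auto simp: f_M_def\<close>)

lemma DERIV_arccos_chain:
  assumes "(f has_real_derivative f') (at x)" "-1 < f x" "f x < 1"
  shows "((\<lambda>x. arccos (f x)) has_real_derivative - (f' / sqrt (1 - (f x)\<^sup>2))) (at x)"
  using DERIV_chain2[OF DERIV_arccos assms(1)] assms by (simp add: divide_inverse mult.commute)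

text \<open>As \<open>r\<close> grows, the lens area grows at the rate of the length
  \<open>2 * r * theta_star r R d\<close> of the arc about \<open>P\<close> inside the disk;
  dividing by \<open>pi * R\<^sup>2\<close> gives the density. The terms caused by the moving angles
  cancel.\<close>

lemma has_real_derivative_F_M_lens:
  assumes R: "R > 0" and d: "d > 0" and r: "\<bar>R - d\<bar> < r" "r < R + d"
  shows "((\<lambda>r. r\<^sup>2 / (pi * R\<^sup>2) * (theta_star r R d - 1/2 * sin (2 * theta_star r R d))
       + 1 / pi * (phi_star r R d - 1/2 * sin (2 * phi_star r R d)))
     has_real_derivative 2 * r * theta_star r R d / (pi * R\<^sup>2)) (at r)"
proof -
  have r0: "r > 0" using r by linarith
  define ct where "ct = (r\<^sup>2 + d\<^sup>2 - R\<^sup>2) / (2 * d * r)"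
  define cp where "cp = (R\<^sup>2 + d\<^sup>2 - r\<^sup>2) / (2 * d * R)"
  have ct: "-1 < ct" "ct < 1"
    unfolding ct_def using R d r r0 by (intro triangle_cosine_strict_bounds; linarith)+
  have cp: "-1 < cp" "cp < 1"
    unfolding cp_def using R d r r0 by (intro triangle_cosine_strict_bounds; linarith)+
  define \<theta> \<phi> where "\<theta> = theta_star r R d" and "\<phi> = phi_star r R d"
  have \<theta>: "\<theta> = arccos ct" and \<phi>: "\<phi> = arccos cp"
    by (simp_all add: \<theta>_def theta_star_def ct_def \<phi>_def phi_star_def cp_def)
  define S where "S = sqrt (1 - ct\<^sup>2)"
  define T where "T = sqrt (1 - cp\<^sup>2)"
  have S: "S > 0" "S\<^sup>2 = 1 - ct\<^sup>2" and T: "T > 0" "T\<^sup>2 = 1 - cp\<^sup>2"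
    using ct cp by (simp_all add: S_def T_def abs_square_less_1 abs_square_le_1 abs_less_iff)
  have trig: "sin (2 * \<theta>) = 2 * S * ct" "cos (2 * \<theta>) = 1 - 2 * S\<^sup>2"
    "cos (2 * \<phi>) = 1 - 2 * T\<^sup>2"
    using ct cp by (simp_all add: \<theta> \<phi> sin_double cos_double sin_arccos cos_arccos S_def[symmetric] T_def[symmetric] S(2) T(2))
  \<comment> \<open>Both sides are half the common chord, as \<open>S\<close> and \<open>T\<close>
    are the sines of the two angles.\<close>
  have "R * T = r * S"
  proof (rule power2_eq_imp_eq)
    have "R\<^sup>2 * (1 - cp\<^sup>2) = r\<^sup>2 * (1 - ct\<^sup>2)"
      using R d r0 by (simp add: cp_def ct_def field_simps power2_eq_square)
    then show "(R * T)\<^sup>2 = (r * S)\<^sup>2" by (simp add: power_mult_distrib S T)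
  qed (use R r0 S T in auto)
  then have T': "T = r * S / R" using R by (simp add: field_simps)
  \<comment> \<open>\<open>ct'\<close> and \<open>cp'\<close> are the derivatives of the two cosines
    in \<open>r\<close>.\<close>
  define ct' where "ct' = 1 / d - ct / r"
  define cp' where "cp' = - r / (d * R)"
  have "((\<lambda>r. (r\<^sup>2 + d\<^sup>2 - R\<^sup>2) / (2 * d * r)) has_real_derivative ct') (at r)"
    using d r0 by (auto intro!: derivative_eq_intros simp: ct'_def ct_def field_simps power2_eq_square)
  then have th: "((\<lambda>r. theta_star r R d) has_real_derivative - (ct' / S)) (at r)"
    using ct unfolding theta_star_def S_def ct_def by (rule DERIV_arccos_chain)
  have "((\<lambda>r. (R\<^sup>2 + d\<^sup>2 - r\<^sup>2) / (2 * d * R)) has_real_derivative cp') (at r)"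
    using d R by (auto intro!: derivative_eq_intros simp: cp'_def field_simps power2_eq_square)
  then have ph: "((\<lambda>r. phi_star r R d) has_real_derivative - (cp' / T)) (at r)"
    using cp unfolding phi_star_def T_def cp_def by (rule DERIV_arccos_chain)
  have "((\<lambda>r. k * r\<^sup>2 * (theta_star r R d - 1/2 * sin (2 * theta_star r R d))
       + m * (phi_star r R d - 1/2 * sin (2 * phi_star r R d)))
     has_real_derivative
       2 * k * r * (\<theta> - 1/2 * sin (2 * \<theta>)) + k * r\<^sup>2 * (- (ct' / S) * (1 - cos (2 * \<theta>)))
       + m * (- (cp' / T) * (1 - cos (2 * \<phi>)))) (at r)" for k m
    by (auto intro!: derivative_eq_intros th ph simp: \<theta>_def \<phi>_def algebra_simps diff_divide_distrib)
  from this[of "1 / (pi * R\<^sup>2)" "1 / pi"]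
  have "((\<lambda>r. r\<^sup>2 / (pi * R\<^sup>2) * (theta_star r R d - 1/2 * sin (2 * theta_star r R d))
       + 1 / pi * (phi_star r R d - 1/2 * sin (2 * phi_star r R d)))
     has_real_derivative
       2 * r / (pi * R\<^sup>2) * (\<theta> - 1/2 * sin (2 * \<theta>)) + r\<^sup>2 / (pi * R\<^sup>2) * (- (ct' / S) * (1 - cos (2 * \<theta>)))
       + 1 / pi * (- (cp' / T) * (1 - cos (2 * \<phi>)))) (at r)"
    by simp
  moreover have "2 * r / (pi * R\<^sup>2) * (\<theta> - 1/2 * sin (2 * \<theta>)) + r\<^sup>2 / (pi * R\<^sup>2) * (- (ct' / S) * (1 - cos (2 * \<theta>)))
       + 1 / pi * (- (cp' / T) * (1 - cos (2 * \<phi>))) = 2 * r * \<theta> / (pi * R\<^sup>2)"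
  proof -
    \<comment> \<open>\<open>1 - cos (2 * \<theta>)\<close> is \<open>2 * S\<^sup>2\<close>, which
      absorbs the \<open>1 / S\<close> from \<open>arccos\<close>. The terms in
      \<open>S * ct\<close> then cancel, and the two left over cancel by the common chord.\<close>
    have *: "- (ct' / S) * (1 - cos (2 * \<theta>)) = - 2 * S * ct'" "- (cp' / T) * (1 - cos (2 * \<phi>)) = - 2 * T * cp'"
      using S(1) T(1) by (simp_all add: trig power2_eq_square)
    show ?thesis
      unfolding * unfolding trig(1) T' ct'_def cp'_def
      using R d r0 by (simp add: field_simps power2_eq_square)
  qed
  ultimately show ?thesis by (simp only: \<theta>_def)
qed

text \<open>Away from the excluded tangency radii, a single branch of \<open>F_M\<close> is valid on
  a whole neighbourhood.\<close>

lemma has_real_derivative_F_M: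
  assumes R: "R > 0" and d: "d \<ge> 0" and r: "r > 0" "r \<noteq> \<bar>R - d\<bar>" "r \<noteq> R + d"
  shows "((\<lambda>r. F_M r R d) has_real_derivative f_M r R d) (at r)"
proof -
  have "r < R - d \<or> \<bar>R - d\<bar> < r \<and> r < R + d \<or> r < d - R \<or> R + d < r"
    using r by linarith
  then consider "r < R - d" | "\<bar>R - d\<bar> < r" "r < R + d" | "r < d - R" | "R + d < r"
    by blast
  then show ?thesis
  proof cases
    case 1
    have "((\<lambda>r. r\<^sup>2 / R\<^sup>2) has_real_derivative 2 * r / R\<^sup>2) (at r)"
      by (rule DERIV_cdivide) (auto intro!: derivative_eq_intros)
    then have "((\<lambda>r. F_M r R d) has_real_derivative 2 * r / R\<^sup>2) (at r)"
      by (rule has_field_derivative_transform_within_open[where S="{0<..<R - d}"])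
        (use 1 r in \<open>auto simp: F_M_def\<close>)
    then show ?thesis using 1 r by (simp add: f_M_def)
  next
    case 2
    then have "d > 0" using d by (cases "d = 0") auto
    from has_real_derivative_F_M_lens[OF R this 2]
    have "((\<lambda>r. F_M r R d) has_real_derivative 2 * r * theta_star r R d / (pi * R\<^sup>2)) (at r)"
      by (rule has_field_derivative_transform_within_open[where S="{\<bar>R - d\<bar><..<R + d}"])
        (use 2 r in \<open>auto simp: F_M_def\<close>)
    then show ?thesis using 2 r by (auto simp: f_M_def)
  next
    case 3
    have "((\<lambda>r. F_M r R d) has_real_derivative 0) (at r)"
      by (rule has_field_derivative_transform_within_open[where S="{0<..<d - R}", OF DERIV_const[of 0]])
        (use 3 r R in \<open>auto simp: F_M_def\<close>)
    then show ?thesis using 3 r R by (simp add: f_M_def)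
  next
    case 4
    have "((\<lambda>r. F_M r R d) has_real_derivative 0) (at r)"
      by (rule has_field_derivative_transform_within_open[where S="{R + d<..}", OF DERIV_const[of 1]])
        (use 4 r R d in \<open>auto simp: F_M_def\<close>)
    then show ?thesis using 4 r R d by (simp add: f_M_def)
  qed
qed

subsection \<open>From distance to Doppler magnitude\<close>

text \<open>Continuity excludes atoms on \<open>S\<close>: a unit mass at one point satisfies
  everything else with \<open>g = 0\<close>. The fundamental theorem of calculus tolerates finitely
  many exceptional points, and half-open intervals generate the Borel sets.\<close>

lemma (in real_distribution) eq_density_of_cdf_derivative:
  assumes S: "finite S"
    and deriv: "\<And>x. x \<notin> S \<Longrightarrow> (cdf M has_real_derivative g x) (at x)"
    and cont: "\<And>x. isCont (cdf M) x"
    and nonneg: "\<And>x. g x \<ge> 0"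
    and [measurable]: "g \<in> borel_measurable borel"
  shows "M = density lborel (\<lambda>x. ennreal (g x))"
proof (rule measure_eqI_generator_eq)
  let ?E = "range (\<lambda>(a, b). {a<..b::real})"
  show "Int_stable ?E"
  proof (rule Int_stableI)
    fix X Y assume "X \<in> ?E" "Y \<in> ?E"
    then obtain a b c e where "X = {a<..b}" "Y = {c<..e}" by auto
    then have "X \<inter> Y = {max a c<..min b e}" by auto
    then show "X \<inter> Y \<in> ?E" by auto
  qed
  show "sets M = sigma_sets UNIV ?E" "sets (density lborel (\<lambda>x. ennreal (g x))) = sigma_sets UNIV ?E"
    by (simp_all add: borel_sigma_sets_Ioc)
  show "range (\<lambda>i. {- real i<..real i}) \<subseteq> ?E" by auto
  show "(\<Union>i. {- real i<..real i}) = UNIV"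
  proof (intro set_eqI iffI UNIV_I)
    fix x :: real
    obtain i where "\<bar>x\<bar> < real i" using reals_Archimedean2 by blast
    then show "x \<in> (\<Union>i. {- real i<..real i})" by (intro UN_I[of i]) auto
  qed
  fix X assume "X \<in> ?E"
  then obtain a b where X: "X = {a<..b}" by auto
  show "emeasure M X = emeasure (density lborel (\<lambda>x. ennreal (g x))) X"
  proof (cases "a < b")
    case True
    then have "(g has_integral (cdf M b - cdf M a)) {a..b}"
      using S deriv cont
      by (intro fundamental_theorem_of_calculus_interior_strong[OF S])
        (auto simp: has_real_derivative_iff_has_vector_derivative[symmetric] intro!: continuous_at_imp_continuous_on)
    then have "(\<integral>\<^sup>+x. ennreal (indicator {a..b} x * g x) \<partial>lborel) = cdf M b - cdf M a"
      using nonneg by (intro nn_integral_has_integral_lebesgue) auto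
    also have "cdf M b - cdf M a = measure M X"
      using cdf_diff_eq[OF True] by (simp add: X)
    finally have "emeasure M X = (\<integral>\<^sup>+x. ennreal (indicator {a..b} x * g x) \<partial>lborel)"
      by (simp add: emeasure_eq_measure)
    \<comment> \<open>The integral is over the closed interval, \<open>X\<close> is half-open; the
      endpoint \<open>a\<close> is null.\<close>
    also have "\<dots> = (\<integral>\<^sup>+x. ennreal (g x) * indicator X x \<partial>lborel)"
      using AE_lborel_singleton[of a]
      by (intro nn_integral_cong_AE) (auto elim!: eventually_mono simp: X indicator_def)
    finally show ?thesis by (simp add: emeasure_density X)
  qed (simp add: X)
qed (auto simp: emeasure_eq_measure)

text \<open>After cross-multiplying and squaring, the common term
  \<open>y\<^sup>2 * z\<^sup>2\<close> drops out and
  \<open>h\<^sup>2 * y\<^sup>2 < h\<^sup>2 * z\<^sup>2\<close> remains.\<close>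

lemma doppler_radius_strict_mono:
  fixes h A :: real
  assumes "h > 0" "A > 0" "0 \<le> y" "y < z"
  shows "A * y / sqrt (h\<^sup>2 + y\<^sup>2) < A * z / sqrt (h\<^sup>2 + z\<^sup>2)"
proof -
  have pos: "h\<^sup>2 + w\<^sup>2 > 0" for w using assms(1) by (simp add: add_pos_nonneg)
  have "y * sqrt (h\<^sup>2 + z\<^sup>2) < z * sqrt (h\<^sup>2 + y\<^sup>2)"
  proof (rule power2_less_imp_less)
    have "y\<^sup>2 < z\<^sup>2" using assms by (intro power_strict_mono) auto
    then show "(y * sqrt (h\<^sup>2 + z\<^sup>2))\<^sup>2 < (z * sqrt (h\<^sup>2 + y\<^sup>2))\<^sup>2"
      using pos[of y] pos[of z] assms(1) by (simp add: power_mult_distrib algebra_simps)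
  qed (use assms in auto)
  moreover have "0 < sqrt (h\<^sup>2 + y\<^sup>2)" "0 < sqrt (h\<^sup>2 + z\<^sup>2)" using pos by simp_all
  ultimately show ?thesis using assms(2) by (simp add: field_simps)
qed

text \<open>Explains the argument of \<open>F_M\<close> in \<open>F_chi\<close>: it is the distance
  at which the magnitude equals \<open>x\<close>.\<close>

lemma doppler_radius_inverse:
  fixes h A x :: real
  assumes "h > 0" "A > 0" "\<bar>x\<bar> < A"
  defines "z \<equiv> h * x / sqrt (A\<^sup>2 - x\<^sup>2)"
  shows "A * z / sqrt (h\<^sup>2 + z\<^sup>2) = x"
proof -
  have "x\<^sup>2 < A\<^sup>2" using assms by (metis abs_ge_zero power2_abs power_strict_mono pos2)
  then have w: "A\<^sup>2 - x\<^sup>2 > 0" by simp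
  have "h\<^sup>2 + z\<^sup>2 = (h * A)\<^sup>2 / (A\<^sup>2 - x\<^sup>2)"
    using w by (simp add: z_def power_divide power_mult_distrib field_simps)
  then have "sqrt (h\<^sup>2 + z\<^sup>2) = h * A / sqrt (A\<^sup>2 - x\<^sup>2)"
    using assms by (simp add: real_sqrt_divide)
  then show ?thesis using w assms by (simp add: z_def)
qed

lemma doppler_radius_le_iff:
  fixes h A x z :: real
  assumes "h > 0" "A > 0" "0 \<le> x" "x < A" "0 \<le> z"
  shows "A * z / sqrt (h\<^sup>2 + z\<^sup>2) \<le> x \<longleftrightarrow> z \<le> h * x / sqrt (A\<^sup>2 - x\<^sup>2)"
proof -
  define y where "y = h * x / sqrt (A\<^sup>2 - x\<^sup>2)"
  have "x\<^sup>2 < A\<^sup>2" using assms by (intro power_strict_mono) auto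
  then have "y \<ge> 0" using assms by (simp add: y_def)
  moreover have "x = A * y / sqrt (h\<^sup>2 + y\<^sup>2)"
    unfolding y_def using assms by (intro doppler_radius_inverse[symmetric]) auto
  ultimately show ?thesis
    unfolding y_def[symmetric] 
    using doppler_radius_strict_mono[of h A y z] doppler_radius_strict_mono[of h A z y] assms
    by (metis less_eq_real_def linorder_not_less order.strict_trans1)
qed

text \<open>\<open>A\<close> is the limit for infinite distance and is never attained.\<close>

lemma doppler_radius_less:
  fixes h A z :: real
  assumes "h > 0" "A > 0"
  shows "A * z / sqrt (h\<^sup>2 + z\<^sup>2) < A"
proof -
  have "z \<le> sqrt (z\<^sup>2)" by simp
  also have "\<dots> < sqrt (h\<^sup>2 + z\<^sup>2)" using assms by (intro real_sqrt_less_mono) auto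
  finally have "z < sqrt (h\<^sup>2 + z\<^sup>2)" .
  moreover have "0 < sqrt (h\<^sup>2 + z\<^sup>2)" using assms by (simp add: add_pos_nonneg)
  ultimately show ?thesis using assms by (simp add: field_simps)
qed

text \<open>The Jacobian factor of \<open>f_chi\<close>; with
  \<open>w = sqrt (A\<^sup>2 - x\<^sup>2)\<close> its numerator
  \<open>h * (w\<^sup>2 + x\<^sup>2)\<close> collapses to \<open>h * A\<^sup>2\<close>.\<close>

lemma has_real_derivative_doppler_radius:
  fixes h A x :: real
  assumes "\<bar>x\<bar> < A"
  shows "((\<lambda>x. h * x / sqrt (A\<^sup>2 - x\<^sup>2)) has_real_derivative h * A\<^sup>2 / (A\<^sup>2 - x\<^sup>2) powr (3/2)) (at x)"
proof -
  have "x\<^sup>2 < A\<^sup>2" using assms by (metis abs_ge_zero power2_abs power_strict_mono pos2)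
  then have pos: "A\<^sup>2 - x\<^sup>2 > 0" by simp
  define w where "w = sqrt (A\<^sup>2 - x\<^sup>2)"
  have w: "w > 0" "w\<^sup>2 = A\<^sup>2 - x\<^sup>2" using pos by (simp_all add: w_def)
  have "(A\<^sup>2 - x\<^sup>2) powr (3/2) = (A\<^sup>2 - x\<^sup>2) powr (1 + 1/2)" by simp
  also have "\<dots> = (A\<^sup>2 - x\<^sup>2) * w" using pos unfolding powr_add by (simp add: w_def powr_half_sqrt)
  finally have p: "(A\<^sup>2 - x\<^sup>2) powr (3/2) = w ^ 3" using w by (simp add: power2_eq_square power3_eq_cube)
  have "((\<lambda>x. h * x / sqrt (A\<^sup>2 - x\<^sup>2)) has_real_derivative (h * w - h * x * (inverse w / 2 * (- (2 * x)))) / (w * w)) (at x)"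
    using pos w(1) by (auto intro!: derivative_eq_intros simp: w_def[symmetric])
  moreover have "(h * w - h * x * (inverse w / 2 * (- (2 * x)))) / (w * w) = h * (w\<^sup>2 + x\<^sup>2) / w ^ 3"
    using w(1) by (simp add: field_simps power2_eq_square power3_eq_cube)
  ultimately show ?thesis by (simp add: p w(2))
qed

lemma has_real_derivative_F_chi:
  assumes R: "R > 0" and d: "d \<ge> 0" and h: "h > 0" and x: "0 < x" "x < A"
    and ne: "h * x / sqrt (A\<^sup>2 - x\<^sup>2) \<notin> {\<bar>R - d\<bar>, R + d}"
  shows "(F_chi h A R d has_real_derivative f_chi h A R d x) (at x)"
proof -
  have "x\<^sup>2 < A\<^sup>2" using x by (intro power_strict_mono) auto
  then have "h * x / sqrt (A\<^sup>2 - x\<^sup>2) > 0" using h x by simp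
  then have "((\<lambda>r. F_M r R d) has_real_derivative f_M (h * x / sqrt (A\<^sup>2 - x\<^sup>2)) R d) (at (h * x / sqrt (A\<^sup>2 - x\<^sup>2)))"
    using R d ne by (intro has_real_derivative_F_M) auto
  moreover have "((\<lambda>x. h * x / sqrt (A\<^sup>2 - x\<^sup>2)) has_real_derivative h * A\<^sup>2 / (A\<^sup>2 - x\<^sup>2) powr (3/2)) (at x)"
    using x by (intro has_real_derivative_doppler_radius) auto
  ultimately have "((\<lambda>x. F_M (h * x / sqrt (A\<^sup>2 - x\<^sup>2)) R d) has_real_derivative
      f_M (h * x / sqrt (A\<^sup>2 - x\<^sup>2)) R d * (h * A\<^sup>2 / (A\<^sup>2 - x\<^sup>2) powr (3/2))) (at x)"
    by (rule DERIV_chain2)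
  then show ?thesis by (simp add: F_chi_def[abs_def] f_chi_def mult.commute)
qed

lemma measure_uniform_cball_sphere:
  fixes P C :: "'a::euclidean_space"
  shows "measure (uniform_measure lborel (cball C R)) (sphere P z) = 0"
proof -
  have "sphere P z \<in> null_sets lborel"
    using negligible_sphere[of P z] by (simp add: negligible_iff_null_sets null_sets_completion_iff)
  then have "emeasure lborel (cball C R \<inter> sphere P z) = 0"
    by (metis emeasure_eq_0 inf_le2 null_setsD1 null_setsD2)
  then show ?thesis by (simp add: measure_def emeasure_uniform_measure)
qed

theorem corollary3:
  fixes M :: "'a measure" and X :: "nat \<Rightarrow> 'a \<Rightarrow> plane"
    and P C :: plane and N :: nat
    and f_c c r_E r_o h omega_s omega_E theta_i omega_F A \<rho> s_t Rh :: real
    and chi_min :: "'a \<Rightarrow> real"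
  assumes "f_c > 0" "c > 0" "r_E > 0" "h > 0" "\<rho> > 0"
    and "omega_s > 0" "omega_E > 0"
    and omega_F: "omega_F = omega_s + omega_E * cos theta_i" "omega_F > 0"
    and r_o: "r_o = r_E + h"
    and A: "A = f_c * r_o * omega_F / c"
    and s_t: "s_t = slant_range P h C"
    and Rh: "Rh = sqrt (s_t\<^sup>2 - h\<^sup>2)"
    and "N \<ge> 1"
    and "prob_space M"
    and indep: "prob_space.indep_vars M (\<lambda>_. borel) X {1..N}"
    and unif: "\<And>i. i \<in> {1..N} \<Longrightarrow> distr M borel (X i) = uniform_measure lborel (cball C \<rho>)"
    and chi_min: "\<And>\<omega>. chi_min \<omega> =
          Min ((\<lambda>i. doppler_mag f_c c omega_F r_E r_o h (dist (X i \<omega>) P)) ` {1..N})"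
  shows "(\<forall>x. 0 \<le> x \<and> x < A \<longrightarrow>
            cdf (distr M borel chi_min) x = 1 - (1 - F_chi h A \<rho> Rh x) ^ N) \<and>
         distributed M lborel chi_min
           (\<lambda>x. if 0 \<le> x \<and> x < A
                then ennreal (real N * (1 - F_chi h A \<rho> Rh x) ^ (N - 1) * f_chi h A \<rho> Rh x)
                else 0)"
proof -
  interpret prob_space M by fact
  note [simp] = \<open>h > 0\<close> \<open>\<rho> > 0\<close> less_imp_le[OF \<open>h > 0\<close>]
  have A0: "A > 0" unfolding A r_o using \<open>f_c > 0\<close> \<open>c > 0\<close> \<open>r_E > 0\<close> omega_F(2)
    by (intro divide_pos_pos mult_pos_pos add_pos_pos) auto
  \<comment> \<open>Pythagoras: removing the altitude from the slant range leaves the horizontal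
    distance.\<close>
  have Rh_eq: "Rh = dist C P"
    by (simp add: Rh s_t slant_range_def dist_prod_def dist_real_def power2_commute)
  define k where "k z = A * z / sqrt (h\<^sup>2 + z\<^sup>2)" for z
  define zeta where "zeta x = h * x / sqrt (A\<^sup>2 - x\<^sup>2)" for x
  have k_doppler: "doppler_mag f_c c omega_F r_E r_o h z = k z" for z
    using \<open>r_E > 0\<close> by (simp add: doppler_mag_def kappa_def k_def A)
  have chi: "chi_min \<omega> = Min ((\<lambda>i. k (dist (X i \<omega>) P)) ` {1..N})" for \<omega>
    by (simp only: chi_min k_doppler)
  have X[measurable]: "X i \<in> borel_measurable M" if "i \<in> {1..N}" for i
    using indep that by (auto simp: indep_vars_def)
  have chi_meas[measurable]: "chi_min \<in> borel_measurable M"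
  proof -
    have "(\<lambda>\<omega>. Min ((\<lambda>i. k (dist (X i \<omega>) P)) ` {1..N})) \<in> borel_measurable M"
      unfolding k_def by (intro borel_measurable_Min) auto
    then show ?thesis by (simp add: chi[abs_def])
  qed
  have chi_attained: "\<exists>i\<in>{1..N}. chi_min \<omega> = k (dist (X i \<omega>) P)" for \<omega>
  proof -
    have "Min ((\<lambda>i. k (dist (X i \<omega>) P)) ` {1..N}) \<in> (\<lambda>i. k (dist (X i \<omega>) P)) ` {1..N}"
      using \<open>N \<ge> 1\<close> by (intro Min_in) auto
    then show ?thesis by (simp only: chi image_iff)
  qed
  have chi_le_iff: "chi_min \<omega> \<le> x \<longleftrightarrow> (\<exists>i\<in>{1..N}. k (dist (X i \<omega>) P) \<le> x)" for \<omega> x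
    using \<open>N \<ge> 1\<close> by (simp add: chi Min_le_iff)
  have event_X: "X i -` B \<inter> space M \<in> events" if "i \<in> {1..N}" "B \<in> sets borel" for i B
    using measurable_sets[OF X[OF that(1)] that(2)] .
  have prob_X: "prob (X i -` B \<inter> space M) = measure (uniform_measure lborel (cball C \<rho>)) B"
    if "i \<in> {1..N}" "B \<in> sets borel" for i B
    using that by (simp add: unif[symmetric] measure_distr)
  define D where "D = distr M borel chi_min"
  interpret D: real_distribution D
    unfolding D_def by (rule real_distribution_distr) (rule chi_meas)
  have cdf_D: "cdf D x = prob {\<omega> \<in> space M. chi_min \<omega> \<le> x}" for x
    by (simp add: cdf_def D_def measure_distr vimage_def Int_def conj_commute)
  have k_nonneg: "k z \<ge> 0" if "z \<ge> 0" for z using that A0 by (simp add: k_def)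
  have k_less: "k z < A" for z unfolding k_def using A0 by (intro doppler_radius_less) auto
  have zeta_nonneg: "zeta x \<ge> 0" if "0 \<le> x" "x < A" for x
  proof -
    have "x\<^sup>2 < A\<^sup>2" using that by (intro power_strict_mono) auto
    then show ?thesis
      unfolding zeta_def using that by (intro divide_nonneg_nonneg mult_nonneg_nonneg) auto
  qed
  have F: "measure (uniform_measure lborel (cball C \<rho>)) (cball P (zeta x)) = F_chi h A \<rho> Rh x"
    if "0 \<le> x" "x < A" for x
    using zeta_nonneg[OF that]
    by (simp add: measure_uniform_cball_cball F_chi_def zeta_def Rh_eq)
  \<comment> \<open>The bound comes from reading \<open>F_chi\<close> as a probability for user 1,
    who exists because \<open>N \<ge> 1\<close>.\<close>
  have F_le_1: "F_chi h A \<rho> Rh x \<le> 1" if "0 \<le> x" "x < A" for x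
    using prob_X[of 1 "cball P (zeta x)"] F[OF that] \<open>N \<ge> 1\<close> prob_le_1
    by (metis atLeastAtMost_iff borel_closed closed_cball order_refl)
  have cdf_mid: "cdf D x = 1 - (1 - F_chi h A \<rho> Rh x) ^ N" if x: "0 \<le> x" "x < A" for x
  proof -
    let ?B = "cball P (zeta x)"
    have le: "k (dist (X i \<omega>) P) \<le> x \<longleftrightarrow> X i \<omega> \<in> ?B" for i \<omega>
      unfolding k_def zeta_def mem_cball dist_commute[of P] using x A0 by (intro doppler_radius_le_iff) auto
    have compl: "prob (X i -` (- ?B) \<inter> space M) = 1 - F_chi h A \<rho> Rh x" if "i \<in> {1..N}" for i
    proof -
      have "X i -` (- ?B) \<inter> space M = space M - (X i -` ?B \<inter> space M)" by auto
      then show ?thesis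
        using event_X[OF that, of ?B] prob_X[OF that, of ?B] F[OF x]
        by (simp add: prob_compl)
    qed
    \<comment> \<open>The minimum exceeds \<open>x\<close> exactly when every user is outside the
      disk \<open>?B\<close>; independence applies to these events, hence the complement.\<close>
    have "{\<omega> \<in> space M. chi_min \<omega> \<le> x} = space M - (\<Inter>i\<in>{1..N}. X i -` (- ?B) \<inter> space M)"
      unfolding chi_le_iff le using \<open>N \<ge> 1\<close> by auto
    moreover have "(\<Inter>i\<in>{1..N}. X i -` (- ?B) \<inter> space M) \<in> events"
      using \<open>N \<ge> 1\<close> by (intro sets.finite_INT) (auto intro!: event_X)
    ultimately have "cdf D x = 1 - prob (\<Inter>i\<in>{1..N}. X i -` (- ?B) \<inter> space M)"
      by (simp add: cdf_D prob_compl)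
    also have "prob (\<Inter>i\<in>{1..N}. X i -` (- ?B) \<inter> space M) = (\<Prod>i\<in>{1..N}. prob (X i -` (- ?B) \<inter> space M))"
      using \<open>N \<ge> 1\<close> by (intro indep_varsD_finite[OF indep]) auto
    also have "\<dots> = (1 - F_chi h A \<rho> Rh x) ^ N"
      by (simp add: compl)
    finally show ?thesis .
  qed
  have cdf_neg: "cdf D x = 0" if "x < 0" for x
  proof -
    have "\<not> chi_min \<omega> \<le> x" for \<omega>
      using that chi_attained[of \<omega>] k_nonneg by (metis linorder_not_less order_le_less_trans zero_le_dist)
    then show ?thesis by (simp add: cdf_D)
  qed
  have cdf_large: "cdf D x = 1" if "A \<le> x" for x
  proof -
    have "chi_min \<omega> \<le> x" for \<omega>
      using that chi_attained[of \<omega>] k_less by (metis less_imp_le order_trans)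
    then show ?thesis by (simp add: cdf_D prob_space)
  qed
  have atom: "measure D {x} = 0" for x
  proof -
    \<comment> \<open>Strict monotonicity leaves at most one distance for each magnitude; if there
      is none, any \<open>z\<close> will do.\<close>
    have "\<exists>z. \<forall>y\<ge>0. k y = x \<longrightarrow> y = z"
      using doppler_radius_strict_mono[OF \<open>h > 0\<close> A0] unfolding k_def
      by (metis linorder_neqE_linordered_idom less_irrefl)
    then obtain z where z: "\<And>y. y \<ge> 0 \<Longrightarrow> k y = x \<Longrightarrow> y = z" by blast
    have "measure D {x} = prob (chi_min -` {x} \<inter> space M)"
      by (simp add: D_def measure_distr)
    also have "\<dots> \<le> prob (\<Union>i\<in>{1..N}. X i -` sphere P z \<inter> space M)"
    proof (rule finite_measure_mono)
      show "chi_min -` {x} \<inter> space M \<subseteq> (\<Union>i\<in>{1..N}. X i -` sphere P z \<inter> space M)"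
      proof
        fix \<omega> assume \<omega>: "\<omega> \<in> chi_min -` {x} \<inter> space M"
        obtain i where i: "i \<in> {1..N}" "chi_min \<omega> = k (dist (X i \<omega>) P)"
          using chi_attained by blast
        with \<omega> have "dist (X i \<omega>) P = z" by (intro z) auto
        with i(1) \<omega> show "\<omega> \<in> (\<Union>i\<in>{1..N}. X i -` sphere P z \<inter> space M)"
          by (intro UN_I[of i]) (auto simp: dist_commute)
      qed
      show "(\<Union>i\<in>{1..N}. X i -` sphere P z \<inter> space M) \<in> events"
        by (intro sets.finite_UN) (auto intro!: event_X)
    qed
    also have "\<dots> \<le> (\<Sum>i\<in>{1..N}. prob (X i -` sphere P z \<inter> space M))"
      by (intro finite_measure_subadditive_finite) (auto intro!: event_X)
    also have "\<dots> = 0"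
      by (simp add: prob_X measure_uniform_cball_sphere)
    finally show ?thesis using measure_nonneg[of D "{x}"] by linarith
  qed
  define g where "g x = (if 0 \<le> x \<and> x < A
      then real N * (1 - F_chi h A \<rho> Rh x) ^ (N - 1) * f_chi h A \<rho> Rh x else 0)" for x
  have g_meas[measurable]: "g \<in> borel_measurable borel"
    unfolding g_def F_chi_def f_chi_def by measurable
  have g_nonneg: "g x \<ge> 0" for x
    using F_le_1[of x] zeta_nonneg[of x] f_M_nonneg[of \<rho> Rh "zeta x"]
    by (auto simp: g_def f_chi_def zeta_def Rh_eq)
  \<comment> \<open>The ends of the support, where \<open>g\<close> is cut off, and the magnitudes
    at which the distance reaches a tangency radius.\<close>
  define S where "S = {0, A} \<union> (zeta -` {\<bar>\<rho> - Rh\<bar>, \<rho> + Rh} \<inter> {0<..<A})"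
  \<comment> \<open>Injectivity makes the preimage of the two tangency radii finite.\<close>
  have "inj_on zeta {0<..<A}"
  proof (rule inj_on_inverseI)
    show "k (zeta x) = x" if "x \<in> {0<..<A}" for x
      unfolding k_def zeta_def using that by (intro doppler_radius_inverse) auto
  qed
  then have S: "finite S"
    unfolding S_def by (intro finite_UnI finite_vimage_IntI) auto
  have deriv: "(cdf D has_real_derivative g x) (at x)" if "x \<notin> S" for x
  proof -
    have "x \<noteq> 0" "x \<noteq> A" using that by (auto simp: S_def)
    then consider "x < 0" | "0 < x" "x < A" | "A < x"
      by (meson linorder_neqE_linordered_idom)
    then show ?thesis
    proof cases
      case 1
      have "(cdf D has_real_derivative 0) (at x)"
        by (rule has_field_derivative_transform_within_open[where S="{..<0}", OF DERIV_const[of 0]])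
          (use 1 in \<open>auto simp: cdf_neg\<close>)
      then show ?thesis using 1 by (simp add: g_def)
    next
      case 2
      then have "(F_chi h A \<rho> Rh has_real_derivative f_chi h A \<rho> Rh x) (at x)"
        using that by (intro has_real_derivative_F_chi) (auto simp: S_def zeta_def Rh_eq)
      then have "((\<lambda>x. 1 - (1 - F_chi h A \<rho> Rh x) ^ N) has_real_derivative g x) (at x)"
        using 2 by (auto intro!: derivative_eq_intros simp: g_def)
      then show ?thesis
        by (rule has_field_derivative_transform_within_open[where S="{0<..<A}"])
          (use 2 in \<open>auto simp: cdf_mid\<close>)
    next
      case 3
      have "(cdf D has_real_derivative 0) (at x)"
        by (rule has_field_derivative_transform_within_open[where S="{A<..}", OF DERIV_const[of 1]])
          (use 3 in \<open>auto simp: cdf_large\<close>)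
      then show ?thesis using 3 by (simp add: g_def)
    qed
  qed
  have cont: "isCont (cdf D) x" for x
    by (simp add: D.isCont_cdf atom)
  have "D = density lborel (\<lambda>x. ennreal (g x))"
    by (rule D.eq_density_of_cdf_derivative[OF S deriv cont g_nonneg g_meas])
  \<comment> \<open>\<open>distributed\<close> asks for the target \<open>lborel\<close>, which has
    the same measurable sets as \<open>borel\<close>.\<close>
  moreover have "D = distr M lborel chi_min"
    unfolding D_def by (intro distr_cong) auto
  ultimately have "distributed M lborel chi_min (\<lambda>x. ennreal (g x))"
    by (simp add: distributed_def)
  moreover have "(\<lambda>x. ennreal (g x)) = (\<lambda>x. if 0 \<le> x \<and> x < A
      then ennreal (real N * (1 - F_chi h A \<rho> Rh x) ^ (N - 1) * f_chi h A \<rho> Rh x) else 0)"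
    by (auto simp: g_def)
  ultimately show ?thesis using cdf_mid by (simp add: D_def)
qed

end
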